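(* Let $\mathcal{G}=(V,\mathcal{E})$ be a connected graph with countable vertex set and with degree bounded by $q$, endowed with a weight function $a$ which is bounded from below by $m>0$ (that is, $a_{x,y}\ge m$ for every edge $\{x,y\}\in\mathcal{E}$) and satisfying the strong isoperimetric inequality: there exists $\kappa>0$ such that $$\mu(A)\le\kappa\cdot a(A)\quad\text{for every finite }A\subset V.$$ Then the critical value $u_*$ for percolation of the vacant set of random interlacements on $\mathcal{G}$ satisfies $$u_*<\infty .$$ In other words, for sufficiently large values of $u$, the vacant set $\mathcal{V}^u$ does not percolate.
   Context: Weighted graphs. $\mathcal{G}=(V,\mathcal{E})$ is connected, $V$ is countable and $\mathcal{E}\subset\{\{x,y\}\subset V;\ x\neq y\}$. A weight function is a symmetric map $a:V\times V\to\mathbb{R}_+$ with $a_{x,y}>0$ iff $\{x,y\}\in\mathcal{E}$. Put $\mu_x=\sum_{y:\{x,y\}\in\mathcal{E}}a_{x,y}$; for finite $A\subset V$, $\mu(A)=\sum_{x\in A}\mu_x$ and $a(A)=\sum_{x\in A,\,y\in A^c}a_{x,y}$. The degree of a vertex is the number of edges incident to it. The weighted graph is transient if the random walk with transition probabilities $a_{x,y}/\mu_x$ is transient (random interlacements are defined on transient weighted graphs; weighted graphs satisfying the strong isoperimetric inequality are transient). Capacity. For finite $K\subset V$, $\mathrm{cap}(K)=\inf\{\frac12\sum_{x,y\in V}|f(x)-f(y)|^2a_{x,y};\ f:V\to\mathbb{R}\text{ finitely supported},\ f\equiv1\text{ on }K\}$. Random interlacements. With $P_x$ the law of the walk from $x$,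 $\widetilde H_K=\inf\{n\ge1;X_n\in K\}$ and $e_K(x)=1_{\{x\in K\}}P_x[\widetilde H_K=\infty]\mu_x$, one has $\mathrm{cap}(K)=\sum_{x\in K}e_K(x)$. $W_+$ (resp. $W$) is the set of nearest-neighbor trajectories indexed by $\mathbb{N}=\{0,1,\dots\}$ (resp. $\mathbb{Z}$) that visit each vertex only finitely many times, with the $\sigma$-algebra generated by the canonical coordinates $X_n$. $W^*$ is the quotient of $W$ by time shift, with projection $\pi^*$ and the $\sigma$-algebra $\{A;(\pi^* )^{-1}(A)\text{ measurable}\}$; $W_K$ is the set of $w\in W$ entering $K$, and $W_K^*=\pi^*(W_K)$. There is a unique $\sigma$-finite measure $\nu$ on $W^*$ such that for each finite $K\subset V$, $1_{W_K^*}\cdot\nu$ is the image under $\pi^*$ of the measure $Q_K$ on $W_K$ given by $Q_K[(X_{-n})_{n\ge0}\in A,X_0=x,(X_n)_{n\ge0}\in B]=P_x[A\mid\widetilde H_K=\infty]\,e_K(x)\,P_x[B]$ for measurable $A,B\subset W_+$ and $x\in V$. Let $\mathbb{P}$ be the law of a Poisson point process $\omega=\sum_i\delta_{(w_i^*,u_i)}$ on $W^*\times\mathbb{R}_+$ with intensity $\nu(dw^* )\otimes du$. The vacant set at level $u\ge0$ is $\mathcal{V}^u=V\setminus\bigcup_{i:u_i\le u}\mathrm{Range}(w_i^* )$. The law $Q^u$ of $(1_{\{x\in\mathcal{V}^u\}})_{x\in V}$ on $\{0,1\}^V$ (with the $\sigma$-algebra generated by the coordinates $Y_x$) is the unique probability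 measure such that $Q^u[Y_x=1\text{ for all }x\in K]=\exp(-u\cdot\mathrm{cap}(K))$ for all finite $K\subset V$. Critical value. $\eta(u,x)=\mathbb{P}[\text{the connected component of }x\text{ in }\mathcal{V}^u\text{ is infinite}]$ and $u_*=\inf\{u\ge0;\eta(u,x)=0\}\in[0,\infty]$, which does not depend on $x\in V$. The vacant set does not percolate if it almost surely has no infinite connected component. *)

theory Defs
  imports "HOL-Probability.Probability"
begin

section \<open>Weighted graphs\<close>

text \<open>The vertex set is a countable type; edges are unordered pairs of distinct vertices.\<close>

locale weighted_graph =
  fixes E :: "'v::countable set set" and a :: "'v \<Rightarrow> 'v \<Rightarrow> real"
  assumes edges: "e \<in> E \<Longrightarrow> \<exists>x y. x \<noteq> y \<and> e = {x, y}"
    and connected: "(x, y) \<in> {(v, w). {v, w} \<in> E}\<^sup>*"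
    and weight_sym: "a x y = a y x"
    and weight_nonneg: "a x y \<ge> 0"
    and weight_pos_iff: "a x y > 0 \<longleftrightarrow> {x, y} \<in> E"

definition degree_bounded :: "'v set set \<Rightarrow> nat \<Rightarrow> bool" where
  "degree_bounded E q \<longleftrightarrow> (\<forall>x. finite {e \<in> E. x \<in> e} \<and> card {e \<in> E. x \<in> e} \<le> q)"

text \<open>On a graph of bounded degree the two unordered sums below have only finitely many
  nonzero terms (for finite \<open>A\<close>), so no question of summability arises.\<close>

definition vertex_weight :: "'v set set \<Rightarrow> ('v \<Rightarrow> 'v \<Rightarrow> real) \<Rightarrow> 'v \<Rightarrow> real" where
  "vertex_weight E a x = (\<Sum>\<^sub>\<infinity>y\<in>{y. {x, y} \<in> E}. a x y)"

definition boundary_weight :: "('v \<Rightarrow> 'v \<Rightarrow> real) \<Rightarrow> 'v set \<Rightarrow> real" where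
  "boundary_weight a A = (\<Sum>\<^sub>\<infinity>(x, y)\<in>A \<times> - A. a x y)"

definition strong_isoperimetric :: "'v set set \<Rightarrow> ('v \<Rightarrow> 'v \<Rightarrow> real) \<Rightarrow> bool" where
  "strong_isoperimetric E a \<longleftrightarrow>
    (\<exists>\<kappa>>0. \<forall>A. finite A \<longrightarrow> (\<Sum>x\<in>A. vertex_weight E a x) \<le> \<kappa> * boundary_weight a A)"

text \<open>The component is empty when \<open>x \<notin> S\<close>.\<close>

definition component_in :: "'v set set \<Rightarrow> 'v set \<Rightarrow> 'v \<Rightarrow> 'v set" where
  "component_in E S x =
    {y. x \<in> S \<and> (x, y) \<in> {(v, w). v \<in> S \<and> w \<in> S \<and> {v, w} \<in> E}\<^sup>*}"


section \<open>Random walk\<close>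

definition is_walk_law ::
  "'v set set \<Rightarrow> ('v \<Rightarrow> 'v \<Rightarrow> real) \<Rightarrow> 'v \<Rightarrow> (nat \<Rightarrow> 'v) measure \<Rightarrow> bool" where
  "is_walk_law E a x P \<longleftrightarrow>
    prob_space P \<and>
    sets P = sets (\<Pi>\<^sub>M n\<in>UNIV. count_space UNIV) \<and>
    (\<forall>n p. measure P {w. \<forall>i\<le>n. w i = p i} =
       (if p 0 = x then \<Prod>i<n. a (p i) (p (Suc i)) / vertex_weight E a (p i) else 0))"

definition equilibrium_weight ::
  "'v set set \<Rightarrow> ('v \<Rightarrow> 'v \<Rightarrow> real) \<Rightarrow> ('v \<Rightarrow> (nat \<Rightarrow> 'v) measure) \<Rightarrow> 'v set \<Rightarrow> 'v \<Rightarrow> real" where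
  "equilibrium_weight E a P K x =
    (if x \<in> K then measure (P x) {w. \<forall>n\<ge>1. w n \<notin> K} * vertex_weight E a x else 0)"


section \<open>Trajectory spaces\<close>

definition one_sided :: "'v set set \<Rightarrow> (nat \<Rightarrow> 'v) set" where
  "one_sided E = {w. (\<forall>n. {w n, w (Suc n)} \<in> E) \<and> (\<forall>x. finite {n. w n = x})}"

definition two_sided :: "'v set set \<Rightarrow> (int \<Rightarrow> 'v) set" where
  "two_sided E = {w. (\<forall>n. {w n, w (n + 1)} \<in> E) \<and> (\<forall>x. finite {n. w n = x})}"

definition one_sided_space :: "'v set set \<Rightarrow> (nat \<Rightarrow> 'v) measure" where
  "one_sided_space E = restrict_space (\<Pi>\<^sub>M n\<in>UNIV. count_space UNIV) (one_sided E)"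

definition two_sided_space :: "'v set set \<Rightarrow> (int \<Rightarrow> 'v) measure" where
  "two_sided_space E = restrict_space (\<Pi>\<^sub>M n\<in>UNIV. count_space UNIV) (two_sided E)"

text \<open>The projection sends a trajectory to its orbit under time shifts.\<close>

definition mod_shift :: "(int \<Rightarrow> 'v) \<Rightarrow> (int \<Rightarrow> 'v) set" where
  "mod_shift w = range (\<lambda>k n. w (n + k))"

definition mod_shift_space :: "'v set set \<Rightarrow> (int \<Rightarrow> 'v) set measure" where
  "mod_shift_space E = sigma (mod_shift ` two_sided E)
    {A. A \<subseteq> mod_shift ` two_sided E \<and>
        mod_shift -` A \<inter> two_sided E \<in> sets (two_sided_space E)}"

definition hitting :: "'v set set \<Rightarrow> 'v set \<Rightarrow> (int \<Rightarrow> 'v) set" where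
  "hitting E K = {w \<in> two_sided E. range w \<inter> K \<noteq> {}}"


section \<open>The intensity measure of random interlacements\<close>

text \<open>\<open>cond_prob\<close> is zero when the conditioning event is null; in that case
  \<open>equilibrium_weight\<close> vanishes as well.\<close>

definition is_hitting_measure ::
  "'v set set \<Rightarrow> ('v \<Rightarrow> 'v \<Rightarrow> real) \<Rightarrow> ('v \<Rightarrow> (nat \<Rightarrow> 'v) measure) \<Rightarrow> 'v set \<Rightarrow>
    (int \<Rightarrow> 'v) measure \<Rightarrow> bool" where
  "is_hitting_measure E a P K Q \<longleftrightarrow>
    sets Q = sets (restrict_space (two_sided_space E) (hitting E K)) \<and>
    (\<forall>x. \<forall>A \<in> sets (one_sided_space E). \<forall>B \<in> sets (one_sided_space E).
      emeasure Q {w \<in> hitting E K. (\<lambda>n. w (- int n)) \<in> A \<and> w 0 = x \<and> (\<lambda>n. w (int n)) \<in> B} =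
      ennreal (cond_prob (P x) (\<lambda>w. w \<in> A) (\<lambda>w. \<forall>n\<ge>1. w n \<notin> K)
        * equilibrium_weight E a P K x * measure (P x) B))"

definition is_interlacement_intensity ::
  "'v set set \<Rightarrow> ('v \<Rightarrow> 'v \<Rightarrow> real) \<Rightarrow> ('v \<Rightarrow> (nat \<Rightarrow> 'v) measure) \<Rightarrow>
    (int \<Rightarrow> 'v) set measure \<Rightarrow> bool" where
  "is_interlacement_intensity E a P \<nu> \<longleftrightarrow>
    sigma_finite_measure \<nu> \<and>
    sets \<nu> = sets (mod_shift_space E) \<and>
    (\<forall>K. finite K \<longrightarrow> (\<exists>Q. is_hitting_measure E a P K Q \<and>
      density \<nu> (indicator (mod_shift ` hitting E K)) = distr Q (mod_shift_space E) mod_shift))"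


section \<open>Poisson point processes\<close>

text \<open>A point measure \<open>\<Sum>\<^sub>i \<delta>\<^bsub>z i\<^esub>\<close> with at most countably many
  (possibly repeated) atoms is represented by a sequence of type \<^typ>\<open>nat \<Rightarrow> 'z option\<close>,
  where \<^term>\<open>None\<close> marks an unused index. The randomness enters only through the
  counts of points, so the enumeration of the atoms is immaterial and is not required to be
  measurable.\<close>

definition point_count :: "(nat \<Rightarrow> 'z option) \<Rightarrow> 'z set \<Rightarrow> ennreal" where
  "point_count \<zeta> D = emeasure (count_space UNIV) {i. \<exists>z\<in>D. \<zeta> i = Some z}"

definition poisson_point_process ::
  "'o measure \<Rightarrow> 'z measure \<Rightarrow> ('o \<Rightarrow> nat \<Rightarrow> 'z option) \<Rightarrow> bool" where
  "poisson_point_process M \<Lambda> \<zeta> \<longleftrightarrow>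
    prob_space M \<and>
    (\<forall>\<omega>\<in>space M. \<forall>i z. \<zeta> \<omega> i = Some z \<longrightarrow> z \<in> space \<Lambda>) \<and>
    (\<forall>D\<in>sets \<Lambda>. (\<lambda>\<omega>. point_count (\<zeta> \<omega>) D) \<in> borel_measurable M) \<and>
    (\<forall>D\<in>sets \<Lambda>. emeasure \<Lambda> D < \<infinity> \<longrightarrow> (\<forall>k::nat.
       measure M {\<omega> \<in> space M. point_count (\<zeta> \<omega>) D = of_nat k} =
         measure \<Lambda> D ^ k / fact k * exp (- measure \<Lambda> D))) \<and>
    (\<forall>D\<in>sets \<Lambda>. emeasure \<Lambda> D = \<infinity> \<longrightarrow>
       (AE \<omega> in M. point_count (\<zeta> \<omega>) D = \<infinity>)) \<and>
    (\<forall>(I::nat set) D. finite I \<longrightarrow> (\<forall>i\<in>I. D i \<in> sets \<Lambda>) \<longrightarrow> disjoint_family_on D I \<longrightarrow>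
       prob_space.indep_vars M (\<lambda>_. borel) (\<lambda>i \<omega>. point_count (\<zeta> \<omega>) (D i)) I)"


section \<open>Vacant set and critical value\<close>

definition vacant_set :: "(nat \<Rightarrow> ((int \<Rightarrow> 'v) set \<times> real) option) \<Rightarrow> real \<Rightarrow> 'v set" where
  "vacant_set \<zeta> u =
    UNIV - (\<Union>(w', t) \<in> {(w', t). t \<le> u \<and> (\<exists>i. \<zeta> i = Some (w', t))}. \<Union>w\<in>w'. range w)"

text \<open>The probability below is that of a measurable event: membership of a vertex \<open>x\<close> in
  the vacant set is the event that some count of points is zero, and the component of \<open>x\<close> is
  determined by countably many such memberships.\<close>

definition percolation_prob ::
  "'v set set \<Rightarrow> 'o measure \<Rightarrow> ('o \<Rightarrow> nat \<Rightarrow> ((int \<Rightarrow> 'v) set \<times> real) option) \<Rightarrow>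
    real \<Rightarrow> 'v \<Rightarrow> real" where
  "percolation_prob E M \<zeta> u x =
    measure M {\<omega> \<in> space M. infinite (component_in E (vacant_set (\<zeta> \<omega>) u) x)}"

definition critical_value ::
  "'v set set \<Rightarrow> 'o measure \<Rightarrow> ('o \<Rightarrow> nat \<Rightarrow> ((int \<Rightarrow> 'v) set \<times> real) option) \<Rightarrow>
    'v \<Rightarrow> ereal" where
  "critical_value E M \<zeta> x = Inf (ereal ` {u. 0 \<le> u \<and> percolation_prob E M \<zeta> u x = 0})"

end

theory Submission
  imports Defs
begin

text \<open>The argument is a Peierls count against the capacity formula. The probability that a finite set
\<open>A\<close> is vacant at level \<open>u\<close> is \<open>exp (- u \<cdot> cap A)\<close>, and under the strong isoperimetric
inequality the capacity of \<open>A\<close> is at least a constant \<open>c\<close> times its cardinality. An infinite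
vacant component containing \<open>x\<close> contains, for each \<open>n\<close>, a self-avoiding path of \<open>n\<close> steps from
\<open>x\<close>; there are at most \<open>q ^ n\<close> of these, and each visits \<open>n + 1\<close> vertices. Hence the
probability of an infinite component is at most \<open>(q \<cdot> exp (- c u)) ^ n\<close> for every \<open>n\<close>, which
vanishes as soon as \<open>c u \<ge> q\<close>, because \<open>q < exp q\<close>.

The linear lower bound on the capacity comes from Cheeger's inequality: a nonnegative finitely
supported \<open>f\<close> satisfies \<open>\<Sum> \<mu> f\<^sup>2 \<le> 2 \<kappa>\<^sup>2 \<cdot> (Dirichlet form of f)\<close> (\<open>spectral_gap\<close>). Let \<open>h n x\<close>
be the probability of visiting \<open>A\<close> within time \<open>n\<close> from \<open>x\<close>. Outside \<open>A\<close> one has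
\<open>h n \<le> h (Suc n)\<close>, and \<open>h (Suc n)\<close> is the neighbour average of \<open>h n\<close>, so summation by parts
bounds the Dirichlet form of \<open>h n\<close> by the total escape weight of \<open>A\<close> up to time \<open>Suc n\<close>. Since
\<open>h n = 1\<close> on \<open>A\<close>, this escape weight is at least \<open>\<mu>(A) / (2 \<kappa>\<^sup>2)\<close>, and letting \<open>n\<close> tend to
infinity gives \<open>capacity_ge\<close>. All functions involved are finitely supported, because the graph
is locally finite.

The total equilibrium weight of \<open>A\<close> is the intensity of the trajectories hitting \<open>A\<close>
(\<open>intensity_ge_capacity\<close>). The description of the intensity only concerns half-trajectories that
visit each vertex finitely often, so transience is needed to see that no mass is lost. It follows
from the same spectral gap, applied to the Green function up to a finite time
(\<open>green_summable\<close>), and the Borel-Cantelli lemma.\<close>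

section \<open>Cheeger's inequality on a finite vertex set\<close>

text \<open>Both sides are additive over the level sets of \<open>g\<close>: removing the lowest positive value \<open>l\<close>
from \<open>g\<close> on its support \<open>A\<close> takes \<open>l \<cdot> 1\<^sub>A\<close> away from \<open>g\<close> and \<open>2 l\<close> times the boundary weight of
\<open>A\<close> from the sum over ordered pairs, and it shrinks the support. This induction replaces the integral
over levels in the co-area formula.\<close>

lemma coarea_isoperimetric:
  fixes a :: "'v \<Rightarrow> 'v \<Rightarrow> real"
  assumes U: "finite U" "B \<subseteq> U"
    and sym: "\<And>x y. a x y = a y x" 
    and iso: "\<And>A. A \<subseteq> B \<Longrightarrow> (\<Sum>x\<in>A. \<Sum>y\<in>U. a x y) \<le> \<kappa> * (\<Sum>x\<in>A. \<Sum>y\<in>U - A. a x y)"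
    and g: "\<And>x. g x \<ge> 0" "\<And>x. x \<notin> B \<Longrightarrow> g x = 0"
  shows "2 * (\<Sum>x\<in>U. g x * (\<Sum>y\<in>U. a x y)) \<le> \<kappa> * (\<Sum>x\<in>U. \<Sum>y\<in>U. a x y * \<bar>g x - g y\<bar>)"
  using g
proof (induction "card {x\<in>B. g x \<noteq> 0}" arbitrary: g rule: less_induct)
  case less
  define A where "A = {x\<in>B. g x \<noteq> 0}"
  have finB: "finite B" using U finite_subset by blast
  have finA: "finite A" and AB: "A \<subseteq> B" and AU: "A \<subseteq> U"
    using finB U by (auto simp: A_def)
  show ?case
  proof (cases "A = {}")
    case True
    then have "g x = 0" for x using less.prems by (auto simp: A_def)
    then show ?thesis by simp
  next
    case False
    define l where "l = Min (g ` A)"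
    have l_le: "l \<le> g x" if "x \<in> A" for x using that finA by (simp add: l_def)
    have "l \<in> g ` A" unfolding l_def using finA False by (intro Min_in) auto
    then obtain z where z: "z \<in> A" "g z = l" by auto
    have l_pos: "l > 0" using z less.prems(1)[of z] by (auto simp: A_def)
    define s :: "'v \<Rightarrow> real" where "s x = (if x \<in> A then 1 else 0)" for x
    define g' where "g' x = g x - l * s x" for x
    have out: "g x = 0" if "x \<notin> A" for x
      using that less.prems(2) by (auto simp: A_def)
    have g'0: "g' x \<ge> 0" for x
      using l_le[of x] out[of x] by (auto simp: g'_def s_def)
    have g'B: "g' x = 0" if "x \<notin> A" for x using that out by (auto simp: g'_def s_def)
    have "{x\<in>B. g' x \<noteq> 0} \<subset> A"
      using z g'B by (auto simp: g'_def s_def)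
    then have "card {x\<in>B. g' x \<noteq> 0} < card A" by (rule psubset_card_mono[OF finA])
    then have IH: "2 * (\<Sum>x\<in>U. g' x * (\<Sum>y\<in>U. a x y))
        \<le> \<kappa> * (\<Sum>x\<in>U. \<Sum>y\<in>U. a x y * \<bar>g' x - g' y\<bar>)"
      using less.hyps[of g'] g'0 g'B AB unfolding A_def by blast
    have split: "\<bar>g x - g y\<bar> = \<bar>g' x - g' y\<bar> + l * (s x * (1 - s y) + s y * (1 - s x))" for x y
      using g'0[of x] g'0[of y] g'B[of x] g'B[of y] l_pos
      by (auto simp: g'_def s_def abs_if)
    have sumA: "(\<Sum>x\<in>U. s x * h x) = (\<Sum>x\<in>A. h x)" for h :: "'v \<Rightarrow> real"
      using U AU by (intro sum.mono_neutral_cong_right) (auto simp: s_def)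
    have sumA': "(\<Sum>x\<in>U. (1 - s x) * h x) = (\<Sum>x\<in>U - A. h x)" for h :: "'v \<Rightarrow> real"
      using U AU by (intro sum.mono_neutral_cong_right) (auto simp: s_def)
    have b1: "(\<Sum>x\<in>U. \<Sum>y\<in>U. a x y * (s x * (1 - s y))) = (\<Sum>x\<in>A. \<Sum>y\<in>U - A. a x y)"
      unfolding sumA[symmetric] sumA'[symmetric] by (simp add: sum_distrib_left mult_ac)
    have b2: "(\<Sum>x\<in>U. \<Sum>y\<in>U. a x y * (s y * (1 - s x))) = (\<Sum>x\<in>A. \<Sum>y\<in>U - A. a x y)"
      unfolding b1[symmetric] by (subst sum.swap) (simp add: sym)
    have "(\<Sum>x\<in>U. \<Sum>y\<in>U. a x y * \<bar>g x - g y\<bar>)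
        = (\<Sum>x\<in>U. \<Sum>y\<in>U. a x y * \<bar>g' x - g' y\<bar>)
          + l * ((\<Sum>x\<in>U. \<Sum>y\<in>U. a x y * (s x * (1 - s y)))
               + (\<Sum>x\<in>U. \<Sum>y\<in>U. a x y * (s y * (1 - s x))))"
      unfolding split by (simp add: ring_distribs sum.distrib sum_distrib_left mult_ac sum_subtractf sum_negf)
    also have "\<dots> = (\<Sum>x\<in>U. \<Sum>y\<in>U. a x y * \<bar>g' x - g' y\<bar>) + 2 * l * (\<Sum>x\<in>A. \<Sum>y\<in>U - A. a x y)"
      unfolding b1 b2 by simp
    finally have r: "(\<Sum>x\<in>U. \<Sum>y\<in>U. a x y * \<bar>g x - g y\<bar>) =
       (\<Sum>x\<in>U. \<Sum>y\<in>U. a x y * \<bar>g' x - g' y\<bar>) + 2 * l * (\<Sum>x\<in>A. \<Sum>y\<in>U - A. a x y)" .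
    have "(\<Sum>x\<in>U. g x * (\<Sum>y\<in>U. a x y))
        = (\<Sum>x\<in>U. g' x * (\<Sum>y\<in>U. a x y)) + l * (\<Sum>x\<in>U. s x * (\<Sum>y\<in>U. a x y))"
      unfolding g'_def sum_distrib_left[of l] sum.distrib[symmetric] by (simp add: algebra_simps)
    then have "2 * (\<Sum>x\<in>U. g x * (\<Sum>y\<in>U. a x y))
        = 2 * (\<Sum>x\<in>U. g' x * (\<Sum>y\<in>U. a x y)) + 2 * l * (\<Sum>x\<in>A. \<Sum>y\<in>U. a x y)"
      unfolding sumA by simp
    also have "\<dots> \<le> \<kappa> * (\<Sum>x\<in>U. \<Sum>y\<in>U. a x y * \<bar>g' x - g' y\<bar>)
          + 2 * l * (\<kappa> * (\<Sum>x\<in>A. \<Sum>y\<in>U - A. a x y))"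
      using IH l_pos iso[OF AB] by (intro add_mono mult_left_mono) auto
    also have "\<dots> = \<kappa> * (\<Sum>x\<in>U. \<Sum>y\<in>U. a x y * \<bar>g x - g y\<bar>)"
      unfolding r by (simp add: algebra_simps)
    finally show ?thesis .
  qed
qed

text \<open>The co-area inequality is applied to \<open>f\<^sup>2\<close>. In \<open>\<bar>f x\<^sup>2 - f y\<^sup>2\<bar> = \<bar>f x - f y\<bar> (f x + f y)\<close> the second
factor is split off by the inequality of arithmetic and geometric means, with weights chosen so
that its contribution is half of the left-hand side and can be absorbed.\<close>

lemma cheeger_finite:
  fixes a :: "'v \<Rightarrow> 'v \<Rightarrow> real"
  assumes U: "finite U" "B \<subseteq> U"
    and sym: "\<And>x y. a x y = a y x" and nonneg: "\<And>x y. a x y \<ge> 0"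
    and \<kappa>: "\<kappa> > 0"
    and iso: "\<And>A. A \<subseteq> B \<Longrightarrow> (\<Sum>x\<in>A. \<Sum>y\<in>U. a x y) \<le> \<kappa> * (\<Sum>x\<in>A. \<Sum>y\<in>U - A. a x y)"
    and f: "\<And>x. f x \<ge> 0" "\<And>x. x \<notin> B \<Longrightarrow> f x = 0"
  shows "(\<Sum>x\<in>U. (f x)\<^sup>2 * (\<Sum>y\<in>U. a x y)) \<le> \<kappa>\<^sup>2 * (\<Sum>x\<in>U. \<Sum>y\<in>U. a x y * (f x - f y)\<^sup>2)"
proof -
  let ?S = "\<Sum>x\<in>U. (f x)\<^sup>2 * (\<Sum>y\<in>U. a x y)"
  have pointwise: "\<kappa> * \<bar>(f x)\<^sup>2 - (f y)\<^sup>2\<bar> \<le> \<kappa>\<^sup>2 * (f x - f y)\<^sup>2 + ((f x)\<^sup>2 + (f y)\<^sup>2) / 2" for x y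
  proof -
    have e: "\<bar>(f x)\<^sup>2 - (f y)\<^sup>2\<bar> = \<bar>f x - f y\<bar> * (f x + f y)"
      using f(1)[of x] f(1)[of y] by (simp add: power2_eq_square abs_mult square_diff_square_factored mult.commute)
    have "\<kappa> * (c * s) \<le> \<kappa>\<^sup>2 * c\<^sup>2 + s\<^sup>2 / 4" for c s :: real
    proof -
      have "0 \<le> (\<kappa> * c - s / 2)\<^sup>2" by simp
      then show ?thesis by (simp add: power2_eq_square algebra_simps)
    qed
    from this[of "\<bar>f x - f y\<bar>" "f x + f y"]
    have 1: "\<kappa> * (\<bar>f x - f y\<bar> * (f x + f y)) \<le> \<kappa>\<^sup>2 * (f x - f y)\<^sup>2 + (f x + f y)\<^sup>2 / 4"
      by simp
    have "0 \<le> (f x - f y)\<^sup>2" by simp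
    then have "(f x + f y)\<^sup>2 / 4 \<le> ((f x)\<^sup>2 + (f y)\<^sup>2) / 2"
      by (simp add: power2_sum power2_diff)
    with 1 show ?thesis unfolding e by linarith
  qed
  have "2 * ?S \<le> \<kappa> * (\<Sum>x\<in>U. \<Sum>y\<in>U. a x y * \<bar>(f x)\<^sup>2 - (f y)\<^sup>2\<bar>)"
    by (rule coarea_isoperimetric[OF U sym iso]) (use f in auto)
  also have "\<dots> = (\<Sum>x\<in>U. \<Sum>y\<in>U. a x y * (\<kappa> * \<bar>(f x)\<^sup>2 - (f y)\<^sup>2\<bar>))"
    by (simp add: sum_distrib_left mult_ac)
  also have "\<dots> \<le> (\<Sum>x\<in>U. \<Sum>y\<in>U. a x y * (\<kappa>\<^sup>2 * (f x - f y)\<^sup>2 + ((f x)\<^sup>2 + (f y)\<^sup>2) / 2))"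
    by (intro sum_mono mult_left_mono pointwise nonneg)
  also have "\<dots> = \<kappa>\<^sup>2 * (\<Sum>x\<in>U. \<Sum>y\<in>U. a x y * (f x - f y)\<^sup>2)
      + ((\<Sum>x\<in>U. \<Sum>y\<in>U. a x y * (f x)\<^sup>2) + (\<Sum>x\<in>U. \<Sum>y\<in>U. a x y * (f y)\<^sup>2)) / 2"
    by (simp add: ring_distribs add_divide_distrib sum.distrib sum_distrib_left sum_divide_distrib mult_ac)
  also have "(\<Sum>x\<in>U. \<Sum>y\<in>U. a x y * (f y)\<^sup>2) = (\<Sum>x\<in>U. \<Sum>y\<in>U. a x y * (f x)\<^sup>2)"
    by (subst sum.swap) (simp add: sym)
  also have "(\<Sum>x\<in>U. \<Sum>y\<in>U. a x y * (f x)\<^sup>2) = ?S"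
    by (simp add: sum_distrib_right mult.commute)
  finally show ?thesis by simp
qed

section \<open>The spectral gap\<close>

text \<open>A graph reduced to a single vertex satisfies the isoperimetric inequality but carries no random
walk; the assumption \<open>has_neighbor\<close> excludes it and makes all vertex weights positive.\<close>

locale isoperimetric_graph = weighted_graph E a
  for E :: "'v::countable set set" and a :: "'v \<Rightarrow> 'v \<Rightarrow> real" +
  fixes q :: nat and m \<kappa> :: real
  assumes degree: "degree_bounded E q"
    and m_pos: "m > 0" and weight_ge: "{x, y} \<in> E \<Longrightarrow> a x y \<ge> m"
    and kappa_pos: "\<kappa> > 0"
    and isoperimetric: "finite A \<Longrightarrow> (\<Sum>x\<in>A. vertex_weight E a x) \<le> \<kappa> * boundary_weight a A"
    and has_neighbor: "\<exists>y. {x, y} \<in> E"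
begin

definition nbrs :: "'v \<Rightarrow> 'v set" where
  "nbrs x = {y. {x, y} \<in> E}"

abbreviation \<mu> :: "'v \<Rightarrow> real" where
  "\<mu> \<equiv> vertex_weight E a"

lemma nbrs_sym: "y \<in> nbrs x \<longleftrightarrow> x \<in> nbrs y"
  by (simp add: nbrs_def insert_commute)

lemma finite_card_nbrs: "finite (nbrs x) \<and> card (nbrs x) \<le> q"
proof -
  have inj: "inj_on (\<lambda>y. {x, y}) (nbrs x)"
    by (auto simp: inj_on_def doubleton_eq_iff)
  have sub: "(\<lambda>y. {x, y}) ` nbrs x \<subseteq> {e \<in> E. x \<in> e}" by (auto simp: nbrs_def)
  have fin: "finite {e \<in> E. x \<in> e}" and c: "card {e \<in> E. x \<in> e} \<le> q"
    using degree by (auto simp: degree_bounded_def)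
  have "finite (nbrs x)" using inj sub fin by (metis finite_imageD finite_subset)
  moreover have "card (nbrs x) \<le> card {e \<in> E. x \<in> e}"
    by (rule card_inj_on_le[OF inj sub fin])
  ultimately show ?thesis using c by simp
qed

lemma finite_nbrs [simp, intro]: "finite (nbrs x)"
  using finite_card_nbrs by blast

lemma weight_zero: "y \<notin> nbrs x \<Longrightarrow> a x y = 0"
  using weight_pos_iff[of x y] weight_nonneg[of x y] by (auto simp: nbrs_def)

lemma vertex_weight_eq: "\<mu> x = (\<Sum>y\<in>nbrs x. a x y)"
  using finite_nbrs[of x] by (simp add: vertex_weight_def nbrs_def)

lemma vertex_weight_ge: "\<mu> x \<ge> m"
proof -
  obtain y where y: "y \<in> nbrs x" using has_neighbor by (auto simp: nbrs_def)
  have "m \<le> a x y" using y weight_ge by (auto simp: nbrs_def)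
  also have "\<dots> \<le> \<mu> x" unfolding vertex_weight_eq
    by (rule member_le_sum) (use y weight_nonneg in auto)
  finally show ?thesis .
qed

lemma vertex_weight_pos [simp]: "\<mu> x > 0"
  using vertex_weight_ge[of x] m_pos by linarith

definition step_avg :: "('v \<Rightarrow> real) \<Rightarrow> 'v \<Rightarrow> real" where
  "step_avg f x = (\<Sum>y\<in>nbrs x. a x y / \<mu> x * f y)"

lemma step_avg_mono: "(\<And>y. f y \<le> g y) \<Longrightarrow> step_avg f x \<le> step_avg g x"
  unfolding step_avg_def
  by (intro sum_mono mult_left_mono divide_nonneg_pos weight_nonneg) auto

lemma step_avg_const [simp]: "step_avg (\<lambda>_. c) x = c"
proof -
  have "step_avg (\<lambda>_. c) x = (\<Sum>y\<in>nbrs x. a x y) / \<mu> x * c"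
    by (simp add: step_avg_def sum_distrib_right sum_divide_distrib)
  also have "\<dots> = c" using vertex_weight_pos[of x] by (simp flip: vertex_weight_eq del: vertex_weight_pos)
  finally show ?thesis .
qed

lemma step_avg_nonneg: "(\<And>y. 0 \<le> f y) \<Longrightarrow> 0 \<le> step_avg f x"
  using step_avg_mono[of "\<lambda>_. 0" f x] by simp

lemma step_avg_diff: "step_avg (\<lambda>y. f y - g y) x = step_avg f x - step_avg g x"
  by (simp add: step_avg_def right_diff_distrib sum_subtractf)

lemma step_avg_sum: "step_avg (\<lambda>y. \<Sum>i\<in>I. f i y) x = (\<Sum>i\<in>I. step_avg (f i) x)"
  unfolding step_avg_def by (subst sum.swap) (simp add: sum_distrib_left)

lemma finite_support_step_avg:
  assumes "finite {x. f x \<noteq> 0}"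
  shows "finite {x. step_avg f x \<noteq> 0}"
proof (rule finite_subset)
  show "{x. step_avg f x \<noteq> 0} \<subseteq> (\<Union>y\<in>{x. f x \<noteq> 0}. nbrs y)"
  proof
    fix x assume "x \<in> {x. step_avg f x \<noteq> 0}"
    then obtain y where "y \<in> nbrs x" "f y \<noteq> 0"
      unfolding step_avg_def using sum.not_neutral_contains_not_neutral by force
    then show "x \<in> (\<Union>y\<in>{x. f x \<noteq> 0}. nbrs y)" using nbrs_sym by auto
  qed
qed (use assms in auto)

text \<open>The finite set \<open>U\<close> of all vertices of \<open>B\<close> and their neighbours carries every edge that meets
\<open>B\<close>, so Cheeger's inequality on \<open>U\<close> is the inequality on the whole graph. The factor 2
arises because the sum over ordered pairs is twice the Dirichlet form, which summation by parts
turns into the right-hand side.\<close>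

lemma spectral_gap:
  assumes B: "finite B" and f: "\<And>x. f x \<ge> 0" "\<And>x. x \<notin> B \<Longrightarrow> f x = 0"
  shows "(\<Sum>x\<in>B. \<mu> x * (f x)\<^sup>2) \<le> 2 * \<kappa>\<^sup>2 * (\<Sum>x\<in>B. \<mu> x * f x * (f x - step_avg f x))"
proof -
  define U where "U = B \<union> (\<Union>x\<in>B. nbrs x)"
  have U: "finite U" "B \<subseteq> U" using B by (auto simp: U_def)
  have mu: "(\<Sum>y\<in>U. a x y * h y) = (\<Sum>y\<in>nbrs x. a x y * h y)" if "x \<in> B" for x h
    by (rule sum.mono_neutral_right) (use that U weight_zero in \<open>auto simp: U_def\<close>)
  have mu1: "(\<Sum>y\<in>U. a x y) = \<mu> x" if "x \<in> B" for x
    using mu[OF that, of "\<lambda>_. 1"] by (simp add: vertex_weight_eq)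
  have iso: "(\<Sum>x\<in>A. \<Sum>y\<in>U. a x y) \<le> \<kappa> * (\<Sum>x\<in>A. \<Sum>y\<in>U - A. a x y)" if A: "A \<subseteq> B" for A
  proof -
    have finA: "finite A" using A B finite_subset by blast
    have "boundary_weight a A = (\<Sum>\<^sub>\<infinity>(x, y)\<in>A \<times> (U - A). a x y)"
      unfolding boundary_weight_def
      by (rule infsum_cong_neutral) (use A weight_zero in \<open>auto simp: U_def\<close>)
    also have "\<dots> = (\<Sum>x\<in>A. \<Sum>y\<in>U - A. a x y)"
      using finA U by (simp add: sum.cartesian_product)
    finally show ?thesis
      using isoperimetric[OF finA] A mu1 by (simp add: subset_iff cong: sum.cong)
  qed
  have "(\<Sum>x\<in>B. \<mu> x * (f x)\<^sup>2) = (\<Sum>x\<in>U. (f x)\<^sup>2 * (\<Sum>y\<in>U. a x y))"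
    by (rule sum.mono_neutral_cong_left) (use U f mu1 in auto)
  also have "\<dots> \<le> \<kappa>\<^sup>2 * (\<Sum>x\<in>U. \<Sum>y\<in>U. a x y * (f x - f y)\<^sup>2)"
    by (rule cheeger_finite[OF U weight_sym weight_nonneg kappa_pos iso f])
  also have "(\<Sum>x\<in>U. \<Sum>y\<in>U. a x y * (f x - f y)\<^sup>2)
      = (\<Sum>x\<in>U. \<Sum>y\<in>U. a x y * f x * (f x - f y)) + (\<Sum>x\<in>U. \<Sum>y\<in>U. a x y * f y * (f y - f x))"
    by (simp flip: sum.distrib) (simp add: power2_eq_square algebra_simps)
  also have "(\<Sum>x\<in>U. \<Sum>y\<in>U. a x y * f y * (f y - f x)) = (\<Sum>x\<in>U. \<Sum>y\<in>U. a x y * f x * (f x - f y))"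
    by (subst sum.swap) (simp add: weight_sym)
  also have "(\<Sum>x\<in>U. \<Sum>y\<in>U. a x y * f x * (f x - f y)) = (\<Sum>x\<in>B. \<mu> x * f x * (f x - step_avg f x))"
  proof (rule sum.mono_neutral_cong_right)
    fix x assume x: "x \<in> B"
    have "(\<Sum>y\<in>U. a x y * f x * (f x - f y)) = f x * ((\<Sum>y\<in>U. a x y) * f x - (\<Sum>y\<in>U. a x y * f y))"
      by (simp add: sum_distrib_left sum_distrib_right right_diff_distrib sum_subtractf mult_ac)
    also have "\<dots> = f x * (\<mu> x * f x - \<mu> x * step_avg f x)"
    proof -
      have "\<mu> x * step_avg f x = (\<Sum>y\<in>nbrs x. a x y * f y)"
        using vertex_weight_pos[of x] unfolding step_avg_def sum_distrib_left
        by (intro sum.cong) (auto simp del: vertex_weight_pos)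
      then show ?thesis using mu[OF x] mu1[OF x] by simp
    qed
    finally show "(\<Sum>y\<in>U. a x y * f x * (f x - f y)) = \<mu> x * f x * (f x - step_avg f x)"
      by (simp add: algebra_simps)
  qed (use U f in auto)
  finally show ?thesis by (simp add: algebra_simps)
qed

section \<open>Escape probabilities and the Green function\<close>

text \<open>The probability that the successive positions of the walk from \<open>x\<close>, from time 1 on, lie in the
listed sets. The sets \<open>- A, \<dots>, - A\<close> give the escape probability from \<open>A\<close> up to a finite time,
and \<open>UNIV, \<dots>, UNIV, {z}\<close> give the transition probability to \<open>z\<close>.\<close>

primrec path_prob :: "'v set list \<Rightarrow> 'v \<Rightarrow> real" where
  "path_prob [] x = 1"
| "path_prob (B # Bs) x = step_avg (\<lambda>y. if y \<in> B then path_prob Bs y else 0) x"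

lemma path_prob_nonneg: "0 \<le> path_prob Bs x"
  by (induction Bs arbitrary: x) (auto intro!: step_avg_nonneg)

lemma path_prob_le_1: "path_prob Bs x \<le> 1"
proof (induction Bs arbitrary: x)
  case (Cons B Bs)
  then have "path_prob (B # Bs) x \<le> step_avg (\<lambda>_. 1) x"
    by (auto simp del: step_avg_const intro!: step_avg_mono)
  then show ?case by simp
qed simp

lemma escape_antimono: "path_prob (replicate (Suc n) B) x \<le> path_prob (replicate n B) x"
proof (induction n arbitrary: x)
  case 0
  show ?case using path_prob_le_1[of "[B]" x] by simp
next
  case (Suc n)
  then show ?case by (auto intro!: step_avg_mono)
qed

text \<open>The spectral gap is applied to the probability \<open>h n\<close> of visiting \<open>A\<close> within time \<open>n\<close>. A vertex
of \<open>A\<close> contributes to the Dirichlet form exactly its weighted escape probability, and a vertex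
outside \<open>A\<close> contributes a nonpositive amount since \<open>h n\<close> increases with \<open>n\<close>.\<close>

lemma escape_sum_ge:
  assumes A: "finite A"
  shows "(\<Sum>x\<in>A. \<mu> x) \<le> 2 * \<kappa>\<^sup>2 * (\<Sum>x\<in>A. \<mu> x * path_prob (replicate (Suc n) (- A)) x)"
proof -
  define h where "h n x = (if x \<in> A then 1 else 1 - path_prob (replicate n (- A)) x)" for n x
  \<comment> \<open>For \<open>x \<notin> A\<close> the right-hand side is \<open>h (Suc n) x\<close>.\<close>
  have avg: "step_avg (h n) x = 1 - path_prob (replicate (Suc n) (- A)) x" for n x
  proof -
    have "h n = (\<lambda>y. 1 - (if y \<in> - A then path_prob (replicate n (- A)) y else 0))"
      by (auto simp: h_def)
    then show ?thesis by (simp add: step_avg_diff)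
  qed
  have fin: "finite {x. h n x \<noteq> 0}" for n
  proof (induction n)
    case 0
    have "{x. h 0 x \<noteq> 0} \<subseteq> A" by (auto simp: h_def)
    then show ?case using A finite_subset by blast
  next
    case (Suc n)
    have "{x. h (Suc n) x \<noteq> 0} \<subseteq> A \<union> {x. step_avg (h n) x \<noteq> 0}"
      unfolding avg by (auto simp: h_def)
    then show ?case using A finite_support_step_avg[OF Suc] finite_subset by blast
  qed
  define B where "B = A \<union> {x. h n x \<noteq> 0}"
  have B: "finite B" "A \<subseteq> B" using A fin by (auto simp: B_def)
  have h0: "h n x \<ge> 0" for x using path_prob_le_1 by (auto simp: h_def)
  have "(\<Sum>x\<in>A. \<mu> x) = (\<Sum>x\<in>A. \<mu> x * (h n x)\<^sup>2)" by (simp add: h_def)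
  also have "\<dots> \<le> (\<Sum>x\<in>B. \<mu> x * (h n x)\<^sup>2)"
    by (rule sum_mono2) (use B in \<open>auto intro!: mult_nonneg_nonneg less_imp_le[OF vertex_weight_pos]\<close>)
  also have "\<dots> \<le> 2 * \<kappa>\<^sup>2 * (\<Sum>x\<in>B. \<mu> x * h n x * (h n x - step_avg (h n) x))"
    by (rule spectral_gap) (use B h0 in \<open>auto simp: B_def\<close>)
  also have "\<dots> \<le> 2 * \<kappa>\<^sup>2 * (\<Sum>x\<in>B. if x \<in> A then \<mu> x * path_prob (replicate (Suc n) (- A)) x else 0)"
  proof (intro mult_left_mono sum_mono)
    fix x
    show "\<mu> x * h n x * (h n x - step_avg (h n) x)
        \<le> (if x \<in> A then \<mu> x * path_prob (replicate (Suc n) (- A)) x else 0)"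
    proof (cases "x \<in> A")
      case True
      then show ?thesis unfolding avg by (simp add: h_def)
    next
      case False
      have "h n x - step_avg (h n) x \<le> 0"
        using escape_antimono[of n "- A" x] False unfolding avg by (simp add: h_def)
      then show ?thesis using False h0[of x] vertex_weight_pos[of x]
        by (auto intro!: mult_nonneg_nonpos mult_nonneg_nonneg simp del: vertex_weight_pos)
    qed
  qed simp
  also have "(\<Sum>x\<in>B. if x \<in> A then \<mu> x * path_prob (replicate (Suc n) (- A)) x else 0)
      = (\<Sum>x\<in>A. \<mu> x * path_prob (replicate (Suc n) (- A)) x)"
    by (rule sum.mono_neutral_cong_right) (use B in auto)
  finally show ?thesis .
qed

text \<open>With \<open>p n y\<close> the probability of being at \<open>z\<close> at time \<open>n\<close> for the walk from \<open>y\<close>, the partial sums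
\<open>G N\<close> of \<open>p\<close> satisfy \<open>G N - step_avg (G N) = p 0 - p (Suc N) \<le> 1\<^bsub>{z}\<^esub>\<close>. The spectral gap
therefore bounds \<open>\<mu> x (G N x)\<^sup>2\<close> by a multiple of \<open>\<mu> z (G N z)\<close>. The case \<open>x = z\<close> bounds
\<open>G N z\<close> uniformly in \<open>N\<close>, and then the general case bounds \<open>G N\<close> everywhere.\<close>

lemma green_summable: "summable (\<lambda>n. path_prob (replicate n UNIV @ [{z}]) y)"
proof -
  define p where "p n y = (case n of 0 \<Rightarrow> (if y = z then 1 else 0)
      | Suc k \<Rightarrow> path_prob (replicate k UNIV @ [{z}]) y)" for n y
  have p0: "p n y \<ge> 0" for n y
    by (cases n) (auto simp: p_def path_prob_nonneg)
  have pSuc: "step_avg (p n) y = p (Suc n) y" for n y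
    by (cases n) (auto simp: p_def intro!: arg_cong[where f = "\<lambda>f. step_avg f y"])
  have fin: "finite {x. p n x \<noteq> 0}" for n
  proof (induction n)
    case 0
    have "{x. p 0 x \<noteq> 0} \<subseteq> {z}" by (auto simp: p_def)
    then show ?case using finite_subset by blast
  next
    case (Suc n)
    then show ?case using finite_support_step_avg[OF Suc] by (simp add: pSuc)
  qed
  define G where "G N x = (\<Sum>n\<le>N. p n x)" for N x
  have G0: "G N x \<ge> 0" for N x by (auto simp: G_def intro!: sum_nonneg p0)
  have tele: "G N x - step_avg (G N) x = p 0 x - p (Suc N) x" for N x
  proof -
    have "step_avg (G N) x = (\<Sum>n\<le>N. p (Suc n) x)"
      unfolding G_def by (simp add: step_avg_sum pSuc)
    then show ?thesis unfolding G_def 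
      using sum_telescope[of "\<lambda>n. p n x" N] by (simp add: sum_subtractf)
  qed
  have energy: "\<mu> x * (G N x)\<^sup>2 \<le> 2 * \<kappa>\<^sup>2 * (\<mu> z * G N z)" for N x
  proof -
    define B where "B = {x, z} \<union> (\<Union>n\<le>N. {x. p n x \<noteq> 0})"
    have B: "finite B" "x \<in> B" "z \<in> B" using fin by (auto simp: B_def)
    have supp: "G N y = 0" if "y \<notin> B" for y using that by (auto simp: B_def G_def intro!: sum.neutral)
    have "\<mu> x * (G N x)\<^sup>2 \<le> (\<Sum>x\<in>B. \<mu> x * (G N x)\<^sup>2)"
      by (rule member_le_sum[of x B "\<lambda>x. \<mu> x * (G N x)\<^sup>2"])
        (use B in \<open>auto intro!: mult_nonneg_nonneg less_imp_le[OF vertex_weight_pos]\<close>)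
    also have "\<dots> \<le> 2 * \<kappa>\<^sup>2 * (\<Sum>x\<in>B. \<mu> x * G N x * (G N x - step_avg (G N) x))"
      by (rule spectral_gap) (use B G0 supp in auto)
    also have "\<dots> \<le> 2 * \<kappa>\<^sup>2 * (\<Sum>x\<in>B. if x = z then \<mu> z * G N z else 0)"
    proof (intro mult_left_mono sum_mono)
      fix x
      have "\<mu> x * G N x * (G N x - step_avg (G N) x) \<le> \<mu> x * G N x * p 0 x"
        unfolding tele using p0[of "Suc N" x] G0[of N x] vertex_weight_pos[of x]
        by (intro mult_left_mono) (auto intro!: mult_nonneg_nonneg simp del: vertex_weight_pos)
      also have "\<dots> = (if x = z then \<mu> z * G N z else 0)" by (simp add: p_def)
      finally show "\<mu> x * G N x * (G N x - step_avg (G N) x) \<le> (if x = z then \<mu> z * G N z else 0)" .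
    qed simp
    also have "\<dots> = 2 * \<kappa>\<^sup>2 * (\<mu> z * G N z)" using B by (simp add: sum.delta)
    finally show ?thesis .
  qed
  have Gz: "G N z \<le> 2 * \<kappa>\<^sup>2" for N
  proof (cases "G N z = 0")
    case False
    then have "\<mu> z * G N z > 0" using G0[of N z] by simp
    moreover have "(\<mu> z * G N z) * G N z \<le> (\<mu> z * G N z) * (2 * \<kappa>\<^sup>2)"
      using energy[of z N] by (simp add: power2_eq_square mult_ac)
    ultimately show ?thesis using mult_le_cancel_left_pos by blast
  qed simp
  have Gy: "G N y \<le> sqrt (2 * \<kappa>\<^sup>2 * (\<mu> z * (2 * \<kappa>\<^sup>2)) / \<mu> y)" for N
  proof (rule real_le_rsqrt)
    have "\<mu> y * (G N y)\<^sup>2 \<le> 2 * \<kappa>\<^sup>2 * (\<mu> z * (2 * \<kappa>\<^sup>2))"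
      using energy[of y N] Gz[of N] vertex_weight_pos[of z]
      by (meson mult_left_mono order_trans zero_le_mult_iff zero_le_numeral zero_le_power2 less_imp_le)
    then show "(G N y)\<^sup>2 \<le> 2 * \<kappa>\<^sup>2 * (\<mu> z * (2 * \<kappa>\<^sup>2)) / \<mu> y"
      using vertex_weight_pos[of y] by (simp add: pos_le_divide_eq mult.commute del: vertex_weight_pos)
  qed
  have "summable (\<lambda>n. p n y)"
  proof (rule summableI_nonneg_bounded[OF p0])
    fix n
    have "(\<Sum>i<n. p i y) \<le> G n y"
      unfolding G_def by (rule sum_mono2) (auto simp: p0)
    then show "(\<Sum>i<n. p i y) \<le> sqrt (2 * \<kappa>\<^sup>2 * (\<mu> z * (2 * \<kappa>\<^sup>2)) / \<mu> y)"
      using Gy[of n] by linarith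
  qed
  then have "summable (\<lambda>n. p (Suc n) y)" by (subst summable_Suc_iff)
  then show ?thesis by (simp add: p_def)
qed

end

section \<open>Transience of the random walk\<close>

locale isoperimetric_walk = isoperimetric_graph E a q m \<kappa>
  for E :: "'v::countable set set" and a q m \<kappa> +
  fixes P :: "'v \<Rightarrow> (nat \<Rightarrow> 'v) measure"
  assumes walk: "is_walk_law E a x (P x)"
begin

lemma prob_space_walk: "prob_space (P x)"
  and sets_walk [measurable_cong]: "sets (P x) = sets (\<Pi>\<^sub>M n\<in>UNIV. count_space UNIV)"
  and walk_cylinder: "measure (P x) {w. \<forall>i\<le>n. w i = p i} =
       (if p 0 = x then \<Prod>i<n. a (p i) (p (Suc i)) / \<mu> (p i) else 0)"
  using walk[of x] unfolding is_walk_law_def by blast+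

lemma space_walk [simp]: "space (P x) = UNIV"
  using sets_eq_imp_space_eq[OF sets_walk, of x] by (simp add: space_PiM)

lemma pred_walk: "Measurable.pred (P x) Q \<Longrightarrow> {w. Q w} \<in> sets (P x)"
  by (simp add: pred_def)

lemma walk_start: "AE w in P x. w 0 = x"
proof -
  interpret prob_space "P x" by (rule prob_space_walk)
  have "measure (P x) {w. \<forall>i\<le>0. w i = x} = 1"
    using walk_cylinder[of x 0 "\<lambda>_. x"] by simp
  then have "AE w in P x. w \<in> {w. \<forall>i\<le>0. w i = x}" by (rule AE_prob_1)
  then show ?thesis by simp
qed

text \<open>A trajectory with a step that is not an edge lies in one of countably many cylinders, one for
each finite sequence of vertices containing such a step, and these are null.\<close>

lemma walk_steps: "AE w in P x. \<forall>n. {w n, w (Suc n)} \<in> E"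
proof -
  interpret prob_space "P x" by (rule prob_space_walk)
  have "AE w in P x. {w n, w (Suc n)} \<in> E" for n
  proof -
    have "AE w in P x. \<forall>l::'v list. l ! Suc n \<notin> nbrs (l ! n) \<longrightarrow> w \<notin> {w. \<forall>i\<le>Suc n. w i = l ! i}"
    proof (subst AE_all_countable, intro allI)
      fix l :: "'v list"
      have "AE w in P x. w \<notin> {w. \<forall>i\<le>Suc n. w i = l ! i}" if "l ! Suc n \<notin> nbrs (l ! n)"
      proof (rule AE_not_in)
        have "measure (P x) {w. \<forall>i\<le>Suc n. w i = l ! i} = 0"
          using weight_zero[OF that] unfolding walk_cylinder by auto
        moreover have "{w. \<forall>i\<le>Suc n. w i = l ! i} \<in> sets (P x)"
          by (rule pred_walk) measurable
        ultimately show "{w. \<forall>i\<le>Suc n. w i = l ! i} \<in> null_sets (P x)"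
          by (simp add: null_sets_def emeasure_eq_measure)
      qed
      then show "AE w in P x. l ! Suc n \<notin> nbrs (l ! n) \<longrightarrow> w \<notin> {w. \<forall>i\<le>Suc n. w i = l ! i}"
        by (cases "l ! Suc n \<notin> nbrs (l ! n)") auto
    qed
    then show ?thesis
    proof (rule AE_mp, intro AE_I2 impI)
      fix w assume *: "\<forall>l::'v list. l ! Suc n \<notin> nbrs (l ! n) \<longrightarrow> w \<notin> {w. \<forall>i\<le>Suc n. w i = l ! i}"
      let ?l = "map w [0..<Suc (Suc n)]"
      have nth: "?l ! i = w i" if "i \<le> Suc n" for i
        using that by (subst nth_map) (auto simp del: upt_Suc)
      then have "w (Suc n) \<in> nbrs (w n)" using spec[OF *, of ?l] by (auto simp del: upt_Suc)
      then show "{w n, w (Suc n)} \<in> E" by (simp add: nbrs_def)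
    qed
  qed
  then show ?thesis by (simp add: AE_all_countable)
qed

text \<open>The Markov property, in the only form used: after an initial segment has been fixed, the
remaining constraints depend on its last vertex alone. The induction on \<open>Bs\<close> extends the
initial segment by one vertex; only neighbours of its last vertex carry mass, so the sum over
extensions is finite.\<close>

lemma walk_cylinder_path_prob:
  "measure (P x) {w. (\<forall>i\<le>k. w i = p i) \<and> (\<forall>i<length Bs. w (Suc (k + i)) \<in> Bs ! i)}
     = measure (P x) {w. \<forall>i\<le>k. w i = p i} * path_prob Bs (p k)"
proof (induction Bs arbitrary: k p)
  case Nil
  then show ?case by simp
next
  case (Cons B Bs)
  interpret prob_space "P x" by (rule prob_space_walk)
  define C where "C y = {w. (\<forall>i\<le>Suc k. w i = (p(Suc k := y)) i) \<and>
      (\<forall>i<length Bs. w (Suc (Suc k + i)) \<in> Bs ! i)}" for y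
  let ?L = "{w. (\<forall>i\<le>k. w i = p i) \<and> (\<forall>i<length (B # Bs). w (Suc (k + i)) \<in> (B # Bs) ! i)}"
  have C_meas: "C y \<in> sets (P x)" for y
    unfolding C_def by (rule pred_walk) measurable
  have C_iff: "w \<in> C y \<longleftrightarrow> (\<forall>i\<le>k. w i = p i) \<and> w (Suc k) = y \<and>
      (\<forall>i<length Bs. w (Suc (Suc k + i)) \<in> Bs ! i)" for w y
    by (auto simp: C_def le_Suc_eq)
  have L_iff: "w \<in> ?L \<longleftrightarrow> (\<exists>y\<in>B. w \<in> C y)" for w
    by (auto simp: C_iff All_less_Suc2 simp del: nth_Cons_Suc)
  have "prob ?L = prob (\<Union>y\<in>nbrs (p k) \<inter> B. C y)"
  proof (rule finite_measure_eq_AE)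
    show "AE w in P x. (w \<in> ?L) = (w \<in> (\<Union>y\<in>nbrs (p k) \<inter> B. C y))"
      using walk_steps[of x]
    proof (rule AE_mp, intro AE_I2 impI)
      fix w assume w: "\<forall>n. {w n, w (Suc n)} \<in> E"
      have "y \<in> nbrs (p k)" if "w \<in> C y" for y
        using w that by (auto simp: C_iff nbrs_def dest: spec[of _ k])
      then show "(w \<in> ?L) = (w \<in> (\<Union>y\<in>nbrs (p k) \<inter> B. C y))" unfolding L_iff by blast
    qed
    show "?L \<in> sets (P x)" by (rule pred_walk) measurable
    show "(\<Union>y\<in>nbrs (p k) \<inter> B. C y) \<in> sets (P x)" using C_meas by auto
  qed
  also have "\<dots> = (\<Sum>y\<in>nbrs (p k) \<inter> B. prob (C y))"
    by (rule finite_measure_finite_Union) (use C_meas in \<open>auto simp: disjoint_family_on_def C_iff\<close>)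
  also have "\<dots> = (\<Sum>y\<in>nbrs (p k) \<inter> B.
      prob {w. \<forall>i\<le>k. w i = p i} * (a (p k) y / \<mu> (p k)) * path_prob Bs y)"
  proof (rule sum.cong)
    fix y
    have "prob {w. \<forall>i\<le>Suc k. w i = (p(Suc k := y)) i}
        = prob {w. \<forall>i\<le>k. w i = p i} * (a (p k) y / \<mu> (p k))"
      unfolding walk_cylinder by simp
    then show "prob (C y) = prob {w. \<forall>i\<le>k. w i = p i} * (a (p k) y / \<mu> (p k)) * path_prob Bs y"
      unfolding C_def Cons.IH by simp
  qed simp
  also have "\<dots> = prob {w. \<forall>i\<le>k. w i = p i} * path_prob (B # Bs) (p k)"
    unfolding path_prob.simps step_avg_def sum_distrib_left
    by (rule sum.mono_neutral_cong_left) auto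
  finally show ?case .
qed

lemma walk_path_prob: "measure (P x) {w. \<forall>i<length Bs. w (Suc i) \<in> Bs ! i} = path_prob Bs x"
proof -
  interpret prob_space "P x" by (rule prob_space_walk)
  have "prob {w. \<forall>i<length Bs. w (Suc i) \<in> Bs ! i}
      = prob {w. (\<forall>i\<le>0. w i = x) \<and> (\<forall>i<length Bs. w (Suc (0 + i)) \<in> Bs ! i)}"
    by (rule finite_measure_eq_AE) (use walk_start[of x] in \<open>auto intro!: pred_walk\<close>)
  also have "\<dots> = path_prob Bs x"
    unfolding walk_cylinder_path_prob walk_cylinder by simp
  finally show ?thesis .
qed

lemma walk_transient: "AE w in P x. w \<in> one_sided E"
proof -
  interpret prob_space "P x" by (rule prob_space_walk)
  have "AE w in P x. finite {n. w n = y}" for y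
  proof -
    have "prob {w. w (Suc n) = y} = path_prob (replicate n UNIV @ [{y}]) x" for n
      unfolding walk_path_prob[symmetric]
      by (intro arg_cong[where f = prob] Collect_cong) (auto simp: nth_append less_Suc_eq)
    then have "summable (\<lambda>n. prob {w. w (Suc n) = y})" by (simp add: green_summable)
    then have "AE w in P x. eventually (\<lambda>n. w \<in> space (P x) - {w. w (Suc n) = y}) sequentially"
      by (intro borel_cantelli_AE1) (auto intro!: pred_walk simp: emeasure_eq_measure)
    then show ?thesis
    proof (rule AE_mp, intro AE_I2 impI)
      fix w assume "eventually (\<lambda>n. w \<in> space (P x) - {w. w (Suc n) = y}) sequentially"
      then obtain N where N: "\<And>n. n \<ge> N \<Longrightarrow> w (Suc n) \<noteq> y"
        by (auto simp: eventually_sequentially)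
      have "{n. w n = y} \<subseteq> {..N}"
      proof
        fix n assume n: "n \<in> {n. w n = y}"
        show "n \<in> {..N}"
        proof (cases n)
          case (Suc k)
          then have "\<not> N \<le> k" using N[of k] n by auto
          then show ?thesis using Suc by simp
        qed simp
      qed
      then show "finite {n. w n = y}" using finite_subset by blast
    qed
  qed
  then have "AE w in P x. \<forall>y. finite {n. w n = y}" by (simp add: AE_all_countable)
  with walk_steps[of x] show ?thesis unfolding one_sided_def by eventually_elim simp
qed

lemma one_sided_measurable: "one_sided E \<in> sets (\<Pi>\<^sub>M n\<in>UNIV. count_space (UNIV::'v set))"
proof -
  have "finite {n. w n = y} \<longleftrightarrow> (\<exists>N. \<forall>n\<ge>N. w n \<noteq> y)" for w :: "nat \<Rightarrow> 'v" and y
    unfolding finite_nat_set_iff_bounded by (auto simp: not_le[symmetric])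
  then have "one_sided E = {w \<in> space (\<Pi>\<^sub>M n\<in>UNIV. count_space UNIV).
      (\<forall>n. w (Suc n) \<in> nbrs (w n)) \<and> (\<forall>y. \<exists>N. \<forall>n\<ge>N. w n \<noteq> y)}"
    by (auto simp: one_sided_def nbrs_def space_PiM)
  also have "\<dots> \<in> sets (\<Pi>\<^sub>M n\<in>UNIV. count_space UNIV)"
    by measurable
  finally show ?thesis .
qed

lemma escape_LIMSEQ:
  "(\<lambda>n. path_prob (replicate n (- K)) x) \<longlonglongrightarrow> measure (P x) {w. \<forall>n\<ge>1. w n \<notin> K}"
proof -
  interpret prob_space "P x" by (rule prob_space_walk)
  let ?A = "\<lambda>n. {w. \<forall>i<n. w (Suc i) \<notin> K}"
  have "(\<lambda>n. prob (?A n)) \<longlonglongrightarrow> prob (\<Inter>n. ?A n)"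
    by (rule finite_Lim_measure_decseq) (auto intro!: pred_walk simp: decseq_def)
  also have "(\<Inter>n. ?A n) = {w. \<forall>n\<ge>1. w n \<notin> K}"
    by (auto simp: Suc_le_eq) (metis Suc_pred lessI)
  also have "(\<lambda>n. prob (?A n)) = (\<lambda>n. path_prob (replicate n (- K)) x)"
    using walk_path_prob[of x "replicate n (- K)" for n] by (simp cong: conj_cong)
  finally show ?thesis .
qed

text \<open>The bound for finite times passes to the limit, and every vertex weighs at least \<open>m\<close>.\<close>

lemma capacity_ge:
  assumes A: "finite A"
  shows "m * card A / (2 * \<kappa>\<^sup>2) \<le> (\<Sum>x\<in>A. equilibrium_weight E a P A x)"
proof -
  have "(\<lambda>n. 2 * \<kappa>\<^sup>2 * (\<Sum>x\<in>A. \<mu> x * path_prob (replicate (Suc n) (- A)) x))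
      \<longlonglongrightarrow> 2 * \<kappa>\<^sup>2 * (\<Sum>x\<in>A. \<mu> x * measure (P x) {w. \<forall>n\<ge>1. w n \<notin> A})"
    by (intro tendsto_intros LIMSEQ_Suc escape_LIMSEQ)
  then have "(\<Sum>x\<in>A. \<mu> x) \<le> 2 * \<kappa>\<^sup>2 * (\<Sum>x\<in>A. \<mu> x * measure (P x) {w. \<forall>n\<ge>1. w n \<notin> A})"
    by (rule LIMSEQ_le_const) (use escape_sum_ge[OF A] in auto)
  moreover have "m * card A \<le> (\<Sum>x\<in>A. \<mu> x)"
    using sum_mono[of A "\<lambda>_. m" \<mu>] vertex_weight_ge by (simp add: mult.commute)
  ultimately show ?thesis using kappa_pos
    by (simp add: equilibrium_weight_def pos_divide_le_eq mult_ac)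
qed

end

section \<open>The intensity of trajectories hitting a finite set\<close>

lemma hitting_measurable: "hitting E K \<in> sets (two_sided_space E)"
proof -
  have [measurable]: "K \<in> sets (count_space UNIV)" by simp
  have "hitting E K = two_sided E \<inter> {w \<in> space (\<Pi>\<^sub>M n\<in>UNIV. count_space UNIV). \<exists>n. w n \<in> K}"
    by (auto simp: hitting_def space_PiM)
  also have "\<dots> \<in> sets (two_sided_space E)"
    unfolding two_sided_space_def sets_restrict_space by (rule imageI) measurable
  finally show ?thesis .
qed

lemma mem_mod_shift: "w \<in> mod_shift w"
  unfolding mod_shift_def by (rule image_eqI[of _ _ 0]) auto

text \<open>Whether a trajectory hits \<open>K\<close> does not change under time shifts; this is what makes the set of
orbits hitting \<open>K\<close> measurable.\<close>

lemma mod_shift_vimage_hitting: "mod_shift -` (mod_shift ` hitting E K) \<inter> two_sided E = hitting E K"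
proof (intro equalityI subsetI)
  fix w assume "w \<in> mod_shift -` (mod_shift ` hitting E K) \<inter> two_sided E"
  then obtain v where v: "v \<in> hitting E K" "mod_shift w = mod_shift v" "w \<in> two_sided E" by auto
  then obtain k where "w = (\<lambda>n. v (n + k))"
    using mem_mod_shift[of w] by (auto simp: mod_shift_def)
  moreover obtain i where "v i \<in> K" using v by (auto simp: hitting_def)
  ultimately have "w (i - k) \<in> K" by simp
  then show "w \<in> hitting E K" using v by (auto simp: hitting_def)
qed (auto simp: hitting_def)

lemma mod_shift_hitting_measurable: "mod_shift ` hitting E K \<in> sets (mod_shift_space E)"
proof -
  have "mod_shift ` hitting E K \<in> {A. A \<subseteq> mod_shift ` two_sided E \<and>
        mod_shift -` A \<inter> two_sided E \<in> sets (two_sided_space E)}"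
    using hitting_measurable[of E K] by (simp add: mod_shift_vimage_hitting) (auto simp: hitting_def)
  then show ?thesis unfolding mod_shift_space_def
    by (subst sets_measure_of) (auto intro: sigma_sets.Basic)
qed

lemma two_sided_halves:
  assumes "w \<in> two_sided E"
  shows "(\<lambda>n. w (- int n)) \<in> one_sided E" "(\<lambda>n. w (int n)) \<in> one_sided E"
proof -
  have step: "{w n, w (n + 1)} \<in> E" and fin: "finite {n. w n = x}" for n x
    using assms by (auto simp: two_sided_def)
  have "{w (- int n), w (- int (Suc n))} \<in> E" for n
    using step[of "- int (Suc n)"] by (simp add: insert_commute)
  moreover have "finite {n. w (- int n) = x}" for x
    using finite_vimageI[OF fin[of x], of "\<lambda>n. - int n"] by (simp add: vimage_def inj_on_def)
  ultimately show "(\<lambda>n. w (- int n)) \<in> one_sided E" by (simp add: one_sided_def)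
  have "{w (int n), w (int (Suc n))} \<in> E" for n
    using step[of "int n"] by (simp add: add.commute)
  moreover have "finite {n. w (int n) = x}" for x
    using finite_vimageI[OF fin[of x], of int] by (simp add: vimage_def)
  ultimately show "(\<lambda>n. w (int n)) \<in> one_sided E" by (simp add: one_sided_def)
qed

context isoperimetric_walk
begin

lemma measure_one_sided: "measure (P x) (one_sided E) = 1"
proof -
  interpret prob_space "P x" by (rule prob_space_walk)
  have "one_sided E \<in> sets (P x)" using one_sided_measurable by (simp add: sets_walk)
  then show ?thesis using walk_transient[of x] by (simp add: prob_eq_1)
qed

lemma cond_prob_one_sided:
  assumes "measure (P x) {w. \<forall>n\<ge>1. w n \<notin> K} \<noteq> 0"
  shows "cond_prob (P x) (\<lambda>w. w \<in> one_sided E) (\<lambda>w. \<forall>n\<ge>1. w n \<notin> K) = 1"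
proof -
  interpret prob_space "P x" by (rule prob_space_walk)
  have one: "one_sided E \<in> sets (P x)" using one_sided_measurable by (simp add: sets_walk)
  have esc: "{w. \<forall>n\<ge>1. w n \<notin> K} \<in> sets (P x)" by (rule pred_walk) measurable
  have "prob {w. w \<in> one_sided E \<and> (\<forall>n\<ge>1. w n \<notin> K)} = prob {w. \<forall>n\<ge>1. w n \<notin> K}"
  proof (rule finite_measure_eq_AE)
    show "AE w in P x. (w \<in> {w. w \<in> one_sided E \<and> (\<forall>n\<ge>1. w n \<notin> K)}) = (w \<in> {w. \<forall>n\<ge>1. w n \<notin> K})"
      using walk_transient[of x] by eventually_elim simp
    show "{w. w \<in> one_sided E \<and> (\<forall>n\<ge>1. w n \<notin> K)} \<in> sets (P x)"
      using sets.Int[OF one esc] unfolding Int_def mem_Collect_eq .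
  qed (rule esc)
  then show ?thesis using assms by (simp add: cond_prob_def)
qed

text \<open>On the set of trajectories hitting \<open>K\<close>, those that are at \<open>x\<close> at time 0 have mass
\<open>equilibrium_weight E a P K x\<close>: the probabilities that the two halves visit each vertex finitely
often are 1 by transience. Trajectories with different positions at time 0 are disjoint.\<close>

lemma intensity_ge_capacity:
  assumes \<nu>: "is_interlacement_intensity E a P \<nu>" and K: "finite K"
  shows "ennreal (\<Sum>x\<in>K. equilibrium_weight E a P K x) \<le> emeasure \<nu> (mod_shift ` hitting E K)"
proof -
  let ?H = "hitting E K" and ?W = "mod_shift ` hitting E K"
  obtain Q where Q: "is_hitting_measure E a P K Q"
    and dens: "density \<nu> (indicator ?W) = distr Q (mod_shift_space E) mod_shift"
    using \<nu> K unfolding is_interlacement_intensity_def by blast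
  have sets_\<nu>: "sets \<nu> = sets (mod_shift_space E)"
    using \<nu> by (simp add: is_interlacement_intensity_def)
  have sets_Q: "sets Q = sets (restrict_space (two_sided_space E) ?H)"
    using Q by (simp add: is_hitting_measure_def)
  have H_sub: "?H \<subseteq> two_sided E" by (auto simp: hitting_def)
  have space_two: "space (two_sided_space E) = two_sided E"
    by (simp add: two_sided_space_def space_restrict_space space_PiM)
  have space_Q: "space Q = ?H"
    using sets_eq_imp_space_eq[OF sets_Q] H_sub space_two by (auto simp: space_restrict_space)
  have Q_sets: "?H \<inter> A \<in> sets Q" if "A \<in> sets (two_sided_space E)" for A
    using that unfolding sets_Q sets_restrict_space by auto
  have "mod_shift \<in> measurable Q (mod_shift_space E)"
    unfolding mod_shift_space_def
  proof (rule measurable_measure_of)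
    show "mod_shift \<in> space Q \<rightarrow> mod_shift ` two_sided E" using space_Q H_sub by auto
    fix y assume "y \<in> {A. A \<subseteq> mod_shift ` two_sided E \<and>
        mod_shift -` A \<inter> two_sided E \<in> sets (two_sided_space E)}"
    then have "?H \<inter> (mod_shift -` y \<inter> two_sided E) \<in> sets Q" by (intro Q_sets) auto
    also have "?H \<inter> (mod_shift -` y \<inter> two_sided E) = mod_shift -` y \<inter> space Q"
      using space_Q H_sub by auto
    finally show "mod_shift -` y \<inter> space Q \<in> sets Q" .
  qed auto
  then have "emeasure Q (mod_shift -` ?W \<inter> space Q) = emeasure (density \<nu> (indicator ?W)) ?W"
    unfolding dens by (rule emeasure_distr[symmetric, OF _ mod_shift_hitting_measurable])
  also have "mod_shift -` ?W \<inter> space Q = ?H" using space_Q by auto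
  also have "emeasure (density \<nu> (indicator ?W)) ?W = emeasure \<nu> ?W"
    using mod_shift_hitting_measurable[of E K] sets_\<nu>
    by (subst emeasure_density) (auto simp flip: indicator_inter_arith)
  finally have QH: "emeasure Q ?H = emeasure \<nu> ?W" .
  define F where "F x = {w \<in> ?H. w 0 = x}" for x
  have F_meas: "F x \<in> sets Q" for x
  proof -
    have "{w \<in> space (\<Pi>\<^sub>M n\<in>UNIV. count_space UNIV). w (0::int) = x}
        \<in> sets (\<Pi>\<^sub>M n\<in>UNIV. count_space (UNIV::'v set))"
      by measurable
    then have "two_sided E \<inter> {w \<in> space (\<Pi>\<^sub>M n\<in>UNIV. count_space UNIV). w 0 = x}
        \<in> sets (two_sided_space E)"
      unfolding two_sided_space_def sets_restrict_space by (rule imageI)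
    from Q_sets[OF this] show ?thesis
      by (rule back_subst[of "\<lambda>A. A \<in> sets Q"]) (use H_sub in \<open>auto simp: F_def space_PiM\<close>)
  qed
  have F: "emeasure Q (F x) = ennreal (equilibrium_weight E a P K x)" for x
  proof -
    have top: "one_sided E \<in> sets (one_sided_space E)"
      using sets.top[of "one_sided_space E"]
      by (simp add: one_sided_space_def space_restrict_space space_PiM)
    have "F x = {w \<in> ?H. (\<lambda>n. w (- int n)) \<in> one_sided E \<and> w 0 = x \<and> (\<lambda>n. w (int n)) \<in> one_sided E}"
      unfolding F_def using two_sided_halves H_sub by blast
    also have "emeasure Q \<dots> = ennreal (cond_prob (P x) (\<lambda>w. w \<in> one_sided E) (\<lambda>w. \<forall>n\<ge>1. w n \<notin> K)
        * equilibrium_weight E a P K x * measure (P x) (one_sided E))"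
      using Q top unfolding is_hitting_measure_def by blast
    also have "\<dots> = ennreal (equilibrium_weight E a P K x)"
    proof (cases "measure (P x) {w. \<forall>n\<ge>1. w n \<notin> K} = 0")
      case True
      then show ?thesis by (simp add: equilibrium_weight_def)
    next
      case False
      then show ?thesis 
        by (simp only: cond_prob_one_sided[OF False] measure_one_sided mult_1_left mult_1_right)
    qed
    finally show ?thesis .
  qed
  have "ennreal (\<Sum>x\<in>K. equilibrium_weight E a P K x) = (\<Sum>x\<in>K. ennreal (equilibrium_weight E a P K x))"
    by (rule sum_ennreal[symmetric])
      (auto simp: equilibrium_weight_def intro!: mult_nonneg_nonneg less_imp_le[OF vertex_weight_pos])
  also have "\<dots> = emeasure Q (\<Union>x\<in>K. F x)"
    unfolding F[symmetric]
    by (rule sum_emeasure) (use F_meas K in \<open>auto simp: disjoint_family_on_def F_def\<close>)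
  also have "\<dots> \<le> emeasure Q ?H"
    by (rule emeasure_mono) (auto simp: F_def simp flip: space_Q)
  finally show ?thesis unfolding QH .
qed

section \<open>Vacancy of a finite set\<close>

text \<open>The event that no trajectory of level at most \<open>u\<close> hits \<open>A\<close>, expressed by a count of points
because these counts are the measurable quantities of a point process.\<close>

definition void_event ::
  "'o measure \<Rightarrow> ('o \<Rightarrow> nat \<Rightarrow> ((int \<Rightarrow> 'v) set \<times> real) option) \<Rightarrow> real \<Rightarrow> 'v set \<Rightarrow> 'o set" where
  "void_event M \<zeta> u A =
    {\<omega> \<in> space M. point_count (\<zeta> \<omega>) (mod_shift ` hitting E A \<times> {0..u}) = 0}"

lemma point_count_eq_0: "point_count z D = 0 \<longleftrightarrow> (\<forall>i. \<forall>p\<in>D. z i \<noteq> Some p)"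
  by (auto simp: point_count_def emeasure_count_space_eq_0)

lemma vacant_imp_void:
  assumes "\<omega> \<in> space M" and A: "A \<subseteq> vacant_set (\<zeta> \<omega>) u"
  shows "\<omega> \<in> void_event M \<zeta> u A"
proof -
  have False if z: "\<zeta> \<omega> i = Some (mod_shift w, t)" and w: "w \<in> hitting E A" and t: "t \<le> u" for i w t
  proof -
    obtain n where "w n \<in> A" using w by (auto simp: hitting_def)
    then have "w n \<in> vacant_set (\<zeta> \<omega>) u" using A by blast
    moreover have "w n \<in> (\<Union>v\<in>mod_shift w. range v)" using mem_mod_shift[of w] by blast
    ultimately show False using z t unfolding vacant_set_def by blast
  qed
  then show ?thesis using assms(1) by (auto simp: void_event_def point_count_eq_0)
qed

text \<open>If the region of the points hitting \<open>A\<close> has finite intensity, the Poisson law at 0 gives the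
exponential of minus the intensity; otherwise the count is almost surely infinite and the event
is null.\<close>

lemma void_event_prob:
  assumes \<nu>: "is_interlacement_intensity E a P \<nu>"
    and ppp: "poisson_point_process M (\<nu> \<Otimes>\<^sub>M restrict_space lborel {0..}) \<zeta>"
    and A: "finite A" and u: "u \<ge> 0"
  shows "void_event M \<zeta> u A \<in> sets M"
    and "measure M (void_event M \<zeta> u A) \<le> exp (- (u * (m * card A / (2 * \<kappa>\<^sup>2))))"
proof -
  let ?\<Lambda> = "\<nu> \<Otimes>\<^sub>M restrict_space lborel {0..}"
  let ?W = "mod_shift ` hitting E A"
  let ?c = "m * card A / (2 * \<kappa>\<^sup>2)"
  define D where "D = ?W \<times> {0..u}"
  interpret M: prob_space M using ppp by (simp add: poisson_point_process_def)
  interpret L: sigma_finite_measure "restrict_space lborel {0::real..}"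
    by (rule sigma_finite_measure_restrict_space) (auto intro: sigma_finite_lborel)
  have W: "?W \<in> sets \<nu>"
    using \<nu> mod_shift_hitting_measurable by (simp add: is_interlacement_intensity_def)
  have I: "{0..u} \<in> sets (restrict_space lborel {0..})"
    by (auto simp: sets_restrict_space_iff)
  have D: "D \<in> sets ?\<Lambda>" unfolding D_def using W I by (rule pair_measureI)
  have "(\<lambda>\<omega>. point_count (\<zeta> \<omega>) D) \<in> borel_measurable M"
    using ppp D by (auto simp: poisson_point_process_def)
  then have ev: "{\<omega> \<in> space M. point_count (\<zeta> \<omega>) D = 0} \<in> sets M"
    by measurable
  then show "void_event M \<zeta> u A \<in> sets M" by (simp add: void_event_def D_def)
  have c0: "?c \<ge> 0" using m_pos by simp
  have "emeasure ?\<Lambda> D = emeasure \<nu> ?W * emeasure (restrict_space lborel {0..}) {0..u}"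
    unfolding D_def using W I by (rule L.emeasure_pair_measure_Times)
  also have "emeasure (restrict_space lborel {0..}) {0..u} = ennreal u"
    using u by (subst emeasure_restrict_space) auto
  finally have \<Lambda>: "emeasure ?\<Lambda> D = emeasure \<nu> ?W * ennreal u" .
  have "ennreal ?c \<le> emeasure \<nu> ?W"
    using intensity_ge_capacity[OF \<nu> A] capacity_ge[OF A] ennreal_leI order_trans by blast
  then have ge: "ennreal (u * ?c) \<le> emeasure ?\<Lambda> D"
    unfolding \<Lambda> ennreal_mult[OF u c0] by (subst mult.commute) (rule mult_right_mono, auto)
  show "measure M (void_event M \<zeta> u A) \<le> exp (- (u * ?c))"
  proof (cases "emeasure ?\<Lambda> D < \<infinity>")
    case True
    have "measure M {\<omega> \<in> space M. point_count (\<zeta> \<omega>) D = of_nat 0}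
        = measure ?\<Lambda> D ^ 0 / fact 0 * exp (- measure ?\<Lambda> D)"
      using ppp D True unfolding poisson_point_process_def by blast
    moreover have "u * ?c \<le> measure ?\<Lambda> D"
      using ge True by (simp add: emeasure_eq_ennreal_measure)
    ultimately show ?thesis by (simp add: void_event_def D_def)
  next
    case False
    then have "AE \<omega> in M. point_count (\<zeta> \<omega>) D = \<infinity>"
      using ppp D by (auto simp: poisson_point_process_def less_top)
    then have "AE \<omega> in M. \<not> point_count (\<zeta> \<omega>) D = 0" by eventually_elim auto
    then have "measure M {\<omega> \<in> space M. point_count (\<zeta> \<omega>) D = 0} = 0"
      using ev by (simp add: M.prob_eq_0)
    then show ?thesis by (simp add: void_event_def D_def)
  qed
qed

end

section \<open>Counting self-avoiding paths\<close>

context isoperimetric_graph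
begin

text \<open>Paths from \<open>x\<close> with \<open>n\<close> steps, listed from the last vertex to the first, so that a path is
extended by \<open>Cons\<close> and its final vertex is its \<open>hd\<close>; dropping elements from the front cuts off
the end of the path.\<close>

primrec rev_paths :: "'v \<Rightarrow> nat \<Rightarrow> 'v list set" where
  "rev_paths x 0 = {[x]}"
| "rev_paths x (Suc n) = (\<Union>xs\<in>rev_paths x n. (\<lambda>y. y # xs) ` nbrs (hd xs))"

lemma rev_paths_length: "xs \<in> rev_paths x n \<Longrightarrow> length xs = Suc n"
  by (induction n arbitrary: xs) auto

lemma finite_rev_paths: "finite (rev_paths x n)"
  by (induction n) auto

lemma card_rev_paths: "card (rev_paths x n) \<le> q ^ n"
proof (induction n)
  case (Suc n)
  have "card (rev_paths x (Suc n)) \<le> (\<Sum>xs\<in>rev_paths x n. card ((\<lambda>y. y # xs) ` nbrs (hd xs)))"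
    unfolding rev_paths.simps by (rule card_UN_le[OF finite_rev_paths])
  also have "\<dots> \<le> (\<Sum>xs\<in>rev_paths x n. q)"
    by (intro sum_mono) (meson card_image_le finite_card_nbrs order_trans)
  also have "\<dots> \<le> q ^ Suc n" using Suc by (simp add: mult.commute)
  finally show ?case .
qed simp

lemma rev_paths_drop: "xs \<in> rev_paths x n \<Longrightarrow> k \<le> n \<Longrightarrow> drop k xs \<in> rev_paths x (n - k)"
proof (induction n arbitrary: xs k)
  case (Suc n)
  then show ?case by (cases k) auto
qed simp

text \<open>A path is followed within \<open>S\<close>; when it returns to a vertex that it has visited, it is cut back
to that visit.\<close>

lemma component_self_avoiding:
  assumes "y \<in> component_in E S x"
  shows "\<exists>n. \<exists>xs\<in>rev_paths x n. distinct xs \<and> set xs \<subseteq> S \<and> hd xs = y"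
proof -
  have xS: "x \<in> S" and "(x, y) \<in> {(v, w). v \<in> S \<and> w \<in> S \<and> {v, w} \<in> E}\<^sup>*"
    using assms by (auto simp: component_in_def)
  from this(2) show ?thesis
  proof (induction rule: rtrancl_induct)
    case base
    show ?case by (rule exI[of _ 0]) (use xS in auto)
  next
    case (step y z)
    then obtain n xs where xs: "xs \<in> rev_paths x n" "distinct xs" "set xs \<subseteq> S" "hd xs = y"
      by blast
    have z: "z \<in> S" "z \<in> nbrs y" using step by (auto simp: nbrs_def)
    show ?case
    proof (cases "z \<in> set xs")
      case True
      then obtain k where k: "k < length xs" "xs ! k = z" by (auto simp: in_set_conv_nth)
      then have "drop k xs \<in> rev_paths x (n - k)" "hd (drop k xs) = z"
        using rev_paths_drop[OF xs(1), of k] rev_paths_length[OF xs(1)] by (auto simp: hd_drop_conv_nth)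
      moreover have "distinct (drop k xs)" "set (drop k xs) \<subseteq> S"
        using xs set_drop_subset[of k xs] by auto
      ultimately show ?thesis by blast
    next
      case False
      have "z # xs \<in> rev_paths x (Suc n)" using xs z by auto
      then show ?thesis using xs z False by (intro exI[of _ "Suc n"] bexI[of _ "z # xs"]) auto
    qed
  qed
qed

text \<open>If no self-avoiding path in \<open>S\<close> has \<open>n\<close> steps, then none is longer, since it could be shortened
to \<open>n\<close> steps; the component then consists of endpoints of finitely many paths.\<close>

lemma infinite_component_self_avoiding:
  assumes "infinite (component_in E S x)"
  shows "\<exists>xs\<in>rev_paths x n. distinct xs \<and> set xs \<subseteq> S"
proof (rule ccontr)
  assume no: "\<not> ?thesis"
  have "component_in E S x \<subseteq> (\<Union>j<n. hd ` rev_paths x j)"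
  proof
    fix y assume "y \<in> component_in E S x"
    then obtain j xs where xs: "xs \<in> rev_paths x j" "distinct xs" "set xs \<subseteq> S" "hd xs = y"
      using component_self_avoiding by blast
    have "j < n"
    proof (rule ccontr)
      assume "\<not> j < n"
      then have "drop (j - n) xs \<in> rev_paths x n" using rev_paths_drop[OF xs(1), of "j - n"] by simp
      then show False using no xs by (meson distinct_drop set_drop_subset subset_trans)
    qed
    then show "y \<in> (\<Union>j<n. hd ` rev_paths x j)" using xs by auto
  qed
  then show False using assms finite_rev_paths finite_subset by (metis finite_UN finite_imageI finite_lessThan)
qed

end

text \<open>The Peierls argument. The event \<open>N n\<close> that some self-avoiding path of \<open>n\<close> steps is
missed by all trajectories has probability at most \<open>r ^ n\<close> with \<open>r < 1\<close>, and an infinite component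
forces all the events \<open>N n\<close>.\<close>

lemma (in isoperimetric_walk) component_finite_AE:
  assumes \<nu>: "is_interlacement_intensity E a P \<nu>"
    and ppp: "poisson_point_process M (\<nu> \<Otimes>\<^sub>M restrict_space lborel {0..}) \<zeta>"
    and u: "u \<ge> q / (m / (2 * \<kappa>\<^sup>2))"
  shows "AE \<omega> in M. finite (component_in E (vacant_set (\<zeta> \<omega>) u) x)"
proof -
  interpret M: prob_space M using ppp by (simp add: poisson_point_process_def)
  define c where "c = m / (2 * \<kappa>\<^sup>2)"
  have c: "c > 0" using m_pos kappa_pos by (simp add: c_def)
  have "real q / c \<ge> 0" using c by simp
  then have u0: "u \<ge> 0" using u unfolding c_def[symmetric] by linarith
  have uc: "u * c \<ge> q" using u c unfolding c_def[symmetric] by (simp add: pos_divide_le_eq)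
  define r where "r = q * exp (- (u * c))"
  have r0: "r \<ge> 0" by (simp add: r_def)
  have "r \<le> q * exp (- real q)" unfolding r_def using uc by (intro mult_left_mono) auto
  also have "\<dots> < 1"
  proof -
    have "real q < exp (real q)" using exp_ge_add_one_self[of "real q"] by linarith
    then show ?thesis by (simp add: exp_minus field_simps)
  qed
  finally have r1: "r < 1" .
  define N where "N n = (\<Union>xs\<in>{xs\<in>rev_paths x n. distinct xs}. void_event M \<zeta> u (set xs))" for n
  have N_meas: "N n \<in> sets M" for n
    unfolding N_def using void_event_prob(1)[OF \<nu> ppp _ u0] finite_rev_paths
    by (intro sets.finite_UN) auto
  have N_prob: "measure M (N n) \<le> r ^ n" for n
  proof -
    have "measure M (N n) \<le> (\<Sum>xs\<in>{xs\<in>rev_paths x n. distinct xs}. measure M (void_event M \<zeta> u (set xs)))"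
      unfolding N_def using void_event_prob(1)[OF \<nu> ppp _ u0] finite_rev_paths
      by (intro M.finite_measure_subadditive_finite) auto
    also have "\<dots> \<le> (\<Sum>xs\<in>{xs\<in>rev_paths x n. distinct xs}. exp (- (u * c)) ^ n)"
    proof (rule sum_mono)
      fix xs assume "xs \<in> {xs\<in>rev_paths x n. distinct xs}"
      then have card: "card (set xs) = Suc n"
        using rev_paths_length distinct_card by fastforce
      have "measure M (void_event M \<zeta> u (set xs)) \<le> exp (- (u * (m * card (set xs) / (2 * \<kappa>\<^sup>2))))"
        by (rule void_event_prob(2)[OF \<nu> ppp _ u0]) simp
      also have "\<dots> \<le> exp (real n * - (u * c))"
      proof -
        have "u * (m * card (set xs) / (2 * \<kappa>\<^sup>2)) = real (Suc n) * (u * c)"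
          by (simp add: card c_def)
        moreover have "real n * (u * c) \<le> real (Suc n) * (u * c)"
          using u0 c by (intro mult_right_mono) auto
        ultimately show ?thesis by simp
      qed
      also have "\<dots> = exp (- (u * c)) ^ n" by (rule exp_of_nat_mult)
      finally show "measure M (void_event M \<zeta> u (set xs)) \<le> exp (- (u * c)) ^ n" .
    qed
    also have "\<dots> = card {xs\<in>rev_paths x n. distinct xs} * exp (- (u * c)) ^ n" by simp
    also have "\<dots> \<le> real (q ^ n) * exp (- (u * c)) ^ n"
    proof (intro mult_right_mono)
      have "card {xs\<in>rev_paths x n. distinct xs} \<le> card (rev_paths x n)"
        by (intro card_mono finite_rev_paths) auto
      then show "real (card {xs\<in>rev_paths x n. distinct xs}) \<le> real (q ^ n)"
        using card_rev_paths[of x n] by linarith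
    qed simp
    also have "\<dots> = r ^ n" by (simp add: r_def power_mult_distrib)
    finally show ?thesis .
  qed
  have N_all: "(\<Inter>n. N n) \<in> sets M" using N_meas by auto
  have "measure M (\<Inter>n. N n) \<le> r ^ n" for n
    using M.finite_measure_mono[OF _ N_meas, of "\<Inter>n. N n" n] N_prob[of n] by (meson INF_lower UNIV_I order_trans)
  then have "measure M (\<Inter>n. N n) \<le> 0"
    using LIMSEQ_le_const[OF LIMSEQ_power_zero[of r]] r0 r1 by auto
  then have "measure M (\<Inter>n. N n) = 0" using measure_nonneg[of M "\<Inter>n. N n"] by linarith
  then have "(\<Inter>n. N n) \<in> null_sets M" using N_all by (simp add: null_sets_def M.emeasure_eq_measure)
  then have "AE \<omega> in M. \<omega> \<notin> (\<Inter>n. N n)" by (rule AE_not_in)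
  then show ?thesis
  proof (rule AE_mp, intro AE_I2 impI)
    fix \<omega> assume \<omega>: "\<omega> \<in> space M" "\<omega> \<notin> (\<Inter>n. N n)"
    show "finite (component_in E (vacant_set (\<zeta> \<omega>) u) x)"
    proof (rule ccontr)
      assume "infinite (component_in E (vacant_set (\<zeta> \<omega>) u) x)"
      then have "\<omega> \<in> N n" for n
        using infinite_component_self_avoiding[of "vacant_set (\<zeta> \<omega>) u" x n] vacant_imp_void[OF \<omega>(1)]
        unfolding N_def by blast
      then show False using \<omega> by blast
    qed
  qed
qed

section \<open>The critical value is finite\<close>

text \<open>A connected graph with an isolated vertex has no other vertex. Every trajectory is then constant,
whereas the walk law gives probability 0 to staying at a vertex without a loop.\<close>

lemma walk_has_neighbor:
  assumes "weighted_graph E a" and "is_walk_law E a x P"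
  shows "\<exists>y. {x, y} \<in> E"
proof (rule ccontr)
  assume iso: "\<nexists>y. {x, y} \<in> E"
  interpret weighted_graph E a by fact
  interpret prob_space P using assms by (simp add: is_walk_law_def)
  have all: "y = x" for y
    using connected[of x y] by (rule converse_rtranclE) (use iso in auto)
  have "a x x = 0" using weight_pos_iff[of x x] weight_nonneg[of x x] iso by (metis order_le_less)
  moreover have "measure P {w. \<forall>i\<le>1. w i = x} = a x x / vertex_weight E a x"
    using assms(2)[unfolded is_walk_law_def, THEN conjunct2, THEN conjunct2,
        rule_format, of 1 "\<lambda>_. x"] by simp
  moreover have "{w. \<forall>i\<le>1. w i = x} = space P"
  proof -
    have "space P = UNIV"
      using assms(2) sets_eq_imp_space_eq[of P] by (auto simp: is_walk_law_def space_PiM)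
    then show ?thesis using all by auto
  qed
  ultimately show False using prob_space by simp
qed

theorem theorem4p1:
  fixes E :: "'v::countable set set"
    and a :: "'v \<Rightarrow> 'v \<Rightarrow> real"
    and q :: nat
    and m :: real
    and P :: "'v \<Rightarrow> (nat \<Rightarrow> 'v) measure"
    and \<nu> :: "(int \<Rightarrow> 'v) set measure"
    and M :: "'o measure"
    and \<zeta> :: "'o \<Rightarrow> nat \<Rightarrow> ((int \<Rightarrow> 'v) set \<times> real) option"
  assumes "weighted_graph E a"
    and "degree_bounded E q"
    and "m > 0" and "\<And>x y. {x, y} \<in> E \<Longrightarrow> a x y \<ge> m"
    and "strong_isoperimetric E a"
    and "\<And>x. is_walk_law E a x (P x)"
    and "is_interlacement_intensity E a P \<nu>"
    and "poisson_point_process M (\<nu> \<Otimes>\<^sub>M restrict_space lborel {0..}) \<zeta>"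
  shows "(\<forall>x. critical_value E M \<zeta> x < \<infinity>) \<and>
    (\<exists>u0\<ge>0. \<forall>u\<ge>u0. AE \<omega> in M. \<forall>x. finite (component_in E (vacant_set (\<zeta> \<omega>) u) x))"
proof -
  obtain \<kappa> where \<kappa>: "\<kappa> > 0"
    "\<And>A. finite A \<Longrightarrow> (\<Sum>x\<in>A. vertex_weight E a x) \<le> \<kappa> * boundary_weight a A"
    using assms(5) unfolding strong_isoperimetric_def by blast
  interpret weighted_graph E a by fact
  interpret isoperimetric_walk E a q m \<kappa> P
    by unfold_locales (use assms \<kappa> walk_has_neighbor[OF assms(1) assms(6)] in auto)
  interpret M: prob_space M using assms(8) by (simp add: poisson_point_process_def)
  define u0 where "u0 = q / (m / (2 * \<kappa>\<^sup>2))"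
  have u0: "u0 \<ge> 0" using m_pos by (simp add: u0_def)
  have fin: "AE \<omega> in M. \<forall>x. finite (component_in E (vacant_set (\<zeta> \<omega>) u) x)" if "u \<ge> u0" for u
    unfolding AE_all_countable
    using component_finite_AE[OF assms(7,8)] that unfolding u0_def by blast
  have "critical_value E M \<zeta> x < \<infinity>" for x
  proof -
    let ?B = "{\<omega> \<in> space M. infinite (component_in E (vacant_set (\<zeta> \<omega>) u0) x)}"
    have "percolation_prob E M \<zeta> u0 x = 0"
    \<comment> \<open>Either \<open>?B\<close> is a null set, or it is not measurable and has measure 0 by convention.\<close>
    proof (cases "?B \<in> sets M")
      case True
      then show ?thesis unfolding percolation_prob_def
        using fin[of u0] by (subst M.prob_Collect_eq_0) (auto elim: eventually_mono)
    qed (simp add: percolation_prob_def measure_notin_sets)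
    then have "critical_value E M \<zeta> x \<le> ereal u0"
      unfolding critical_value_def using u0 by (intro Inf_lower) auto
    then show ?thesis by (auto simp: le_less_trans)
  qed
  then show ?thesis using fin u0 by blast
qed

end
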